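(* Let $f,g:\mathbb{R}^n\to\mathbb{R}\cup\{\infty\}$ be closed, proper, convex functions, let $\gamma>0$, $z^0\in\mathbb{R}^n$, and let $x^{k+1/2},x^{k+1},z^{k+1}$ ($k=0,1,\dots$) be the DRS iterates. Suppose $d^\star=p^\star$ is finite, the primal problem (P) is feasible, but (P) has no solution. Then $x^{k+1}-x^{k+1/2}\to 0$, \[ \lim_{k\to\infty}\frac{1}{k+1}\sum_{i=0}^{k}\bigl(f(x^{i+1/2})+g(x^{i+1})\bigr)=p^\star,\qquad \liminf_{k\to\infty}\bigl(f(x^{k+1/2})+g(x^{k+1})\bigr)=p^\star , \] and the sequence $(x^{k+1/2},x^{k+1})_{k\ge 0}$ does not converge.
   Context: A convex function is closed if its epigraph is closed, and proper if it is finite somewhere. $\mathrm{dom} f=\{x: f(x)<\infty\}$. $f^*(\nu)=\sup_x\{\langle \nu,x\rangle-f(x)\}$ is the convex conjugate. Primal problem (P): minimize $f(x)+g(x)$ over $x\in\mathbb{R}^n$, with optimal value $p^\star=\inf_x\{f(x)+g(x)\}\in[-\infty,\infty]$. It is feasible if $\mathrm{dom} f\cap\mathrm{dom} g\neq\emptyset$. Dual problem (D): maximize $-f^*(\nu)-g^*(-\nu)$ over $\nu\in\mathbb{R}^n$, with optimal value $d^\star=\sup_\nu\{-f^*(\nu)-g^*(-\nu)\}\in[-\infty,\infty]$. A solution of (P) is a point attaining the optimal value $p^\star$. $\mathrm{Prox}_h(z)=\arg\min_x\{h(x)+\tfrac12\|x-z\|^2\}$. Douglas--Rachford splitting (DRS)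 with parameter $\gamma>0$ and starting point $z^0\in\mathbb{R}^n$: for $k=0,1,\dots$, $x^{k+1/2}=\mathrm{Prox}_{\gamma f}(z^k)$, $x^{k+1}=\mathrm{Prox}_{\gamma g}(2x^{k+1/2}-z^k)$, $z^{k+1}=z^k+x^{k+1}-x^{k+1/2}$. *)

theory Defs
  imports "HOL-Analysis.Analysis"
begin

text \<open>Functions into $\mathbb{R} \cup \{\infty\}$ are modelled as functions into \<^typ>\<open>ereal\<close>
  that never take the value \<open>-\<infinity>\<close>; this is required separately wherever such a function occurs.
  It makes the sums \<open>f x + g x\<close> and the right-hand side of the convexity inequality
  free of the ill-defined form \<open>\<infinity> + (-\<infinity>)\<close>; note also \<open>0 * \<infinity> = 0\<close> in \<^typ>\<open>ereal\<close>.\<close>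

definition edom :: "('a \<Rightarrow> ereal) \<Rightarrow> 'a set" where
  "edom f = {x. f x < \<infinity>}"

definition eepigraph :: "('a \<Rightarrow> ereal) \<Rightarrow> ('a \<times> real) set" where
  "eepigraph f = {(x, t). f x \<le> ereal t}"

definition convex_fun :: "('a::real_vector \<Rightarrow> ereal) \<Rightarrow> bool" where
  "convex_fun f \<longleftrightarrow>
     (\<forall>x y. \<forall>u\<ge>0. \<forall>v\<ge>0. u + v = 1 \<longrightarrow>
        f (u *\<^sub>R x + v *\<^sub>R y) \<le> ereal u * f x + ereal v * f y)"

definition closed_fun :: "('a::topological_space \<Rightarrow> ereal) \<Rightarrow> bool" where
  "closed_fun f \<longleftrightarrow> closed (eepigraph f)"

definition proper_fun :: "('a \<Rightarrow> ereal) \<Rightarrow> bool" where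
  "proper_fun f \<longleftrightarrow> (\<exists>x. \<bar>f x\<bar> \<noteq> \<infinity>)"

definition conjugate :: "('a::real_inner \<Rightarrow> ereal) \<Rightarrow> 'a \<Rightarrow> ereal" where
  "conjugate f \<nu> = (SUP x. ereal (\<nu> \<bullet> x) - f x)"

definition primal_value :: "('a \<Rightarrow> ereal) \<Rightarrow> ('a \<Rightarrow> ereal) \<Rightarrow> ereal" where
  "primal_value f g = (INF x. f x + g x)"

text \<open>For proper \<open>f\<close> and \<open>g\<close> the conjugates never take the value \<open>-\<infinity>\<close>, so the
  difference below is well defined as well.\<close>

definition dual_value :: "('a::real_inner \<Rightarrow> ereal) \<Rightarrow> ('a \<Rightarrow> ereal) \<Rightarrow> ereal" where
  "dual_value f g = (SUP \<nu>. - conjugate f \<nu> - conjugate g (- \<nu>))"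

definition primal_feasible :: "('a \<Rightarrow> ereal) \<Rightarrow> ('a \<Rightarrow> ereal) \<Rightarrow> bool" where
  "primal_feasible f g \<longleftrightarrow> edom f \<inter> edom g \<noteq> {}"

definition primal_solution :: "('a \<Rightarrow> ereal) \<Rightarrow> ('a \<Rightarrow> ereal) \<Rightarrow> 'a \<Rightarrow> bool" where
  "primal_solution f g x \<longleftrightarrow> f x + g x = primal_value f g"

text \<open>\<^const>\<open>arg_min\<close> chooses some minimizer; for closed, proper, convex \<open>h\<close> the minimizer
  exists and is unique.\<close>

definition prox :: "('a::real_inner \<Rightarrow> ereal) \<Rightarrow> 'a \<Rightarrow> 'a" where
  "prox h z = arg_min (\<lambda>x. h x + ereal (1/2 * (norm (x - z))\<^sup>2)) (\<lambda>_. True)"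

text \<open>\<open>xh k\<close> is the half step $x^{k+1/2}$, and \<open>x (Suc k)\<close> is $x^{k+1}$; \<open>x 0\<close> plays no role.\<close>

definition drs_iterates ::
  "('a::real_inner \<Rightarrow> ereal) \<Rightarrow> ('a \<Rightarrow> ereal) \<Rightarrow> real \<Rightarrow> 'a \<Rightarrow>
   (nat \<Rightarrow> 'a) \<Rightarrow> (nat \<Rightarrow> 'a) \<Rightarrow> (nat \<Rightarrow> 'a) \<Rightarrow> bool" where
  "drs_iterates f g \<gamma> z0 xh x z \<longleftrightarrow>
     z 0 = z0 \<and>
     (\<forall>k. xh k = prox (\<lambda>y. ereal \<gamma> * f y) (z k) \<and>
          x (Suc k) = prox (\<lambda>y. ereal \<gamma> * g y) (2 *\<^sub>R xh k - z k) \<and>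
          z (Suc k) = z k + x (Suc k) - xh k)"

end

theory Submission
  imports Defs
begin

text \<open>Write \<open>a\<^sub>k, b\<^sub>k\<close> for the two proximal points of step \<open>k\<close>, \<open>d\<^sub>k = b\<^sub>k - a\<^sub>k = z\<^sub>k\<^sub>+\<^sub>1 - z\<^sub>k\<close>
  and \<open>S\<^sub>k = f a\<^sub>k + g b\<^sub>k\<close>. The proof plays two bounds for \<open>S\<^sub>k\<close> against each other.

  \<^item> Adding the subgradient inequalities that characterise the two proximal points and testing
    them at any common point \<open>x\<close> of the domains gives
    \<open>2 \<gamma> (S\<^sub>k - (f x + g x)) \<le> \<parallel>x - z\<^sub>k\<parallel>\<^sup>2 - \<parallel>x - z\<^sub>k\<^sub>+\<^sub>1\<parallel>\<^sup>2 - \<parallel>d\<^sub>k\<parallel>\<^sup>2\<close> (\<open>step_upper_bound\<close>).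
  \<^item> The Fenchel--Young inequality gives, for any dual point \<open>\<nu>\<close> of dual value \<open>D\<close>,
    \<open>S\<^sub>k \<ge> D - \<nu> \<bullet> d\<^sub>k\<close> (\<open>step_lower_bound\<close>).

  Both telescope. Since there is no duality gap, \<open>x\<close> and \<open>\<nu>\<close> can be chosen with
  \<open>f x + g x - D\<close> as small as desired, even when neither problem has a solution; the two
  bounds together then show that \<open>\<Sum>\<^sub>k\<^sub><\<^sub>K \<parallel>d\<^sub>k\<parallel>\<^sup>2 + \<parallel>x - z\<^sub>K\<parallel>\<^sup>2 / 2\<close> is at most \<open>\<epsilon> K + O(1)\<close>
  (\<open>energy_bound\<close>). As \<open>\<parallel>d\<^sub>k\<parallel>\<close> decreases, because the iteration map is nonexpansive, this forces
  \<open>d\<^sub>k \<rightarrow> 0\<close>, and it also gives \<open>z\<^sub>K / K \<rightarrow> 0\<close>. Dividing the telescoped bounds by \<open>K\<close> yields the limit of the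
  averages. The pointwise lower bound with \<open>d\<^sub>k \<rightarrow> 0\<close> yields \<open>liminf S\<^sub>k \<ge> p\<^sup>\<star>\<close>, while
  \<open>S\<^sub>k > p\<^sup>\<star> + \<epsilon>\<close> for all large \<open>k\<close> would make \<open>\<parallel>x - z\<^sub>k\<parallel>\<^sup>2\<close> decrease to \<open>-\<infinity>\<close>.
  Finally, if the iterates converged, then \<open>d\<^sub>k \<rightarrow> 0\<close> would give both the same limit, at which
  lower semicontinuity bounds \<open>f + g\<close> by \<open>liminf S\<^sub>k = p\<^sup>\<star>\<close>: a solution of (P).

  A finite dual value supplies affine minorants of \<open>f\<close> and \<open>g\<close>, and these make the
  proximal objectives coercive, so that the minimizers exist (\<open>prox_attained\<close>).\<close>

section \<open>Lower semicontinuity and affine minorants\<close>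

lemma closed_fun_limit_le:
  fixes h :: "'a::topological_space \<Rightarrow> ereal"
  assumes "closed_fun h" "X \<longlonglongrightarrow> l" "t \<longlonglongrightarrow> s" "\<And>n. h (X n) \<le> ereal (t n)"
  shows "h l \<le> ereal s"
proof -
  have "(\<lambda>n. (X n, t n)) \<longlonglongrightarrow> (l, s)"
    using assms by (intro tendsto_Pair)
  moreover have "(X n, t n) \<in> eepigraph h" for n
    using assms by (simp add: eepigraph_def)
  ultimately have "(l, s) \<in> eepigraph h"
    using assms(1) unfolding closed_fun_def by (intro Lim_in_closed_set) auto
  then show ?thesis by (simp add: eepigraph_def)
qed

lemma closed_fun_le_liminf:
  fixes h :: "'a::topological_space \<Rightarrow> ereal"
  assumes "closed_fun h" "X \<longlonglongrightarrow> l"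
  shows "h l \<le> liminf (\<lambda>n. h (X n))"
  unfolding le_Liminf_iff
proof (intro allI impI)
  fix y assume "y < h l"
  then obtain t where t: "y < ereal t" "ereal t < h l"
    using ereal_dense2 by blast
  have "(l, t) \<in> - eepigraph h" "open (- eepigraph h)"
    using assms(1) t by (auto simp: eepigraph_def closed_fun_def open_Compl)
  moreover have "(\<lambda>n. (X n, t)) \<longlonglongrightarrow> (l, t)"
    using assms(2) by (intro tendsto_Pair tendsto_const)
  ultimately have "\<forall>\<^sub>F n in sequentially. (X n, t) \<in> - eepigraph h"
    using topological_tendstoD by blast
  then show "\<forall>\<^sub>F n in sequentially. y < h (X n)"
    by (rule eventually_mono) (use t in \<open>auto simp: eepigraph_def\<close>)
qed

lemma conjugate_affine_minorant:
  fixes h :: "'a::real_inner \<Rightarrow> ereal"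
  assumes "conjugate h \<nu> = ereal c" "h y \<noteq> -\<infinity>"
  shows "ereal (\<nu> \<bullet> y - c) \<le> h y"
proof -
  have "ereal (\<nu> \<bullet> y) - h y \<le> ereal c"
    unfolding assms(1)[symmetric] conjugate_def by (rule SUP_upper) simp
  then show ?thesis using assms(2) by (cases "h y") auto
qed

lemma conjugate_not_MInfty:
  fixes h :: "'a::real_inner \<Rightarrow> ereal"
  assumes "proper_fun h"
  shows "conjugate h \<nu> \<noteq> -\<infinity>"
proof -
  obtain y where y: "\<bar>h y\<bar> \<noteq> \<infinity>" using assms unfolding proper_fun_def by metis
  have "ereal (\<nu> \<bullet> y) - h y \<le> conjugate h \<nu>"
    unfolding conjugate_def by (rule SUP_upper) simp
  then show ?thesis using y by (cases "h y") auto
qed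

section \<open>The proximal step\<close>

text \<open>The affine minorant makes the objective \<open>\<phi>\<close> grow quadratically, so a minimizing sequence is
  bounded and has a convergent subsequence; along it the values of \<open>h\<close> converge as well, and
  closedness of the epigraph passes to the limit. The choice made by \<^const>\<open>arg_min\<close> is therefore a
  genuine minimizer.\<close>

lemma prox_attained:
  fixes h :: "'a::euclidean_space \<Rightarrow> ereal"
  assumes closed: "closed_fun h" and proper: "proper_fun h"
    and "\<gamma> > 0" and minorant: "\<And>y. ereal (\<nu> \<bullet> y - c) \<le> h y"
  shows "ereal \<gamma> * h (prox (\<lambda>y. ereal \<gamma> * h y) w)
           + ereal (1/2 * (norm (prox (\<lambda>y. ereal \<gamma> * h y) w - w))\<^sup>2)
         \<le> ereal \<gamma> * h y + ereal (1/2 * (norm (y - w))\<^sup>2)"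
proof -
  define \<phi> where "\<phi> y = \<gamma> * real_of_ereal (h y) + 1/2 * (norm (y - w))\<^sup>2" for y
  define D where "D = {y. \<bar>h y\<bar> \<noteq> \<infinity>}"
  have nMI: "h y \<noteq> -\<infinity>" for y using minorant[of y] by auto
  have low: "\<gamma> * (\<nu> \<bullet> w - c) + (1/4 * (norm (y - w))\<^sup>2 - \<gamma>\<^sup>2 * (norm \<nu>)\<^sup>2) \<le> \<phi> y" if "y \<in> D" for y
  proof -
    obtain r where r: "h y = ereal r" using \<open>y \<in> D\<close> by (auto simp: D_def)
    have 1: "\<gamma> * (\<nu> \<bullet> y - c) \<le> \<gamma> * r" using minorant[of y] r \<open>\<gamma> > 0\<close> by simp
    \<comment> \<open>Half of the quadratic term remains; completing the square in the other half absorbs the linear term.\<close>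
    have "0 \<le> (norm (2 *\<^sub>R (\<gamma> *\<^sub>R \<nu>) + (y - w)))\<^sup>2" by simp
    also have "\<dots> = 4 * \<gamma>\<^sup>2 * (norm \<nu>)\<^sup>2 + 4 * \<gamma> * (\<nu> \<bullet> y - \<nu> \<bullet> w) + (norm (y - w))\<^sup>2"
      unfolding power2_norm_eq_inner
      by (simp add: inner_simps inner_commute algebra_simps power2_eq_square)
    finally show ?thesis using 1 r unfolding \<phi>_def by (simp add: algebra_simps)
  qed
  obtain x0 where x0: "x0 \<in> D" using proper unfolding proper_fun_def D_def by (metis mem_Collect_eq)
  define m where "m = Inf (\<phi> ` D)"
  have bdd: "bdd_below (\<phi> ` D)"
  proof (rule bdd_belowI2)
    fix y assume "y \<in> D"
    have "0 \<le> (norm (y - w))\<^sup>2" by simp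
    then show "\<gamma> * (\<nu> \<bullet> w - c) - \<gamma>\<^sup>2 * (norm \<nu>)\<^sup>2 \<le> \<phi> y"
      using low[OF \<open>y \<in> D\<close>] by linarith
  qed
  have "\<exists>y\<in>D. \<phi> y < m + 1 / real (Suc n)" for n
    using cInf_lessD[of "\<phi> ` D" "m + 1 / real (Suc n)"] x0 unfolding m_def by force
  then obtain Y where Y: "\<And>n. Y n \<in> D" "\<And>n. \<phi> (Y n) < m + 1 / real (Suc n)" by metis
  have mY: "m \<le> \<phi> (Y n)" for n unfolding m_def using bdd Y(1) by (simp add: cINF_lower)
  have lim\<phi>: "(\<lambda>n. \<phi> (Y n)) \<longlonglongrightarrow> m"
  proof (rule tendsto_sandwich[of "\<lambda>_. m" _ _ "\<lambda>n. m + 1 / real (Suc n)"])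
    show "(\<lambda>n. m + 1 / real (Suc n)) \<longlonglongrightarrow> m"
      using tendsto_add[OF tendsto_const LIMSEQ_inverse_real_of_nat] by (simp add: inverse_eq_divide)
  qed (use mY less_imp_le[OF Y(2)] in simp_all)
  define B where "B = 4 * (m + 1 - \<gamma> * (\<nu> \<bullet> w - c) + \<gamma>\<^sup>2 * (norm \<nu>)\<^sup>2)"
  have "Y n \<in> cball w (sqrt B)" for n
  proof -
    have "1 / real (Suc n) \<le> 1" by simp
    then have "1/4 * (norm (Y n - w))\<^sup>2 \<le> m + 1 - \<gamma> * (\<nu> \<bullet> w - c) + \<gamma>\<^sup>2 * (norm \<nu>)\<^sup>2"
      using low[OF Y(1)[of n]] Y(2)[of n] by linarith
    then have "(norm (Y n - w))\<^sup>2 \<le> B" unfolding B_def by simp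
    then show ?thesis by (simp add: dist_norm norm_minus_commute real_le_rsqrt)
  qed
  then obtain l r where r: "strict_mono r" "(Y \<circ> r) \<longlonglongrightarrow> l"
    using compact_cball[of w "sqrt B"] unfolding compact_def by metis
  have "(\<lambda>n. (\<phi> ((Y \<circ> r) n) - 1/2 * (norm ((Y \<circ> r) n - w))\<^sup>2) / \<gamma>)
          \<longlonglongrightarrow> (m - 1/2 * (norm (l - w))\<^sup>2) / \<gamma>"
    using LIMSEQ_subseq_LIMSEQ[OF lim\<phi> r(1)] r(2) \<open>\<gamma> > 0\<close>
    by (intro tendsto_intros) (auto simp: comp_def)
  moreover have "h ((Y \<circ> r) n) \<le> ereal ((\<phi> ((Y \<circ> r) n) - 1/2 * (norm ((Y \<circ> r) n - w))\<^sup>2) / \<gamma>)" for n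
    using Y(1)[of "r n"] \<open>\<gamma> > 0\<close> by (auto simp: D_def \<phi>_def)
  ultimately have hl: "h l \<le> ereal ((m - 1/2 * (norm (l - w))\<^sup>2) / \<gamma>)"
    using closed_fun_limit_le[OF closed r(2)] by blast
  have min_l: "ereal \<gamma> * h l + ereal (1/2 * (norm (l - w))\<^sup>2)
                 \<le> ereal \<gamma> * h y + ereal (1/2 * (norm (y - w))\<^sup>2)" for y
  proof (cases "y \<in> D")
    case True
    then obtain s where s: "h y = ereal s" by (auto simp: D_def)
    obtain t where t: "h l = ereal t" using hl nMI[of l] by (cases "h l") auto
    have "\<gamma> * t \<le> m - 1/2 * (norm (l - w))\<^sup>2"
      using hl t \<open>\<gamma> > 0\<close> by (simp add: field_simps)
    moreover have "m \<le> \<phi> y" unfolding m_def using bdd True by (simp add: cINF_lower)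
    ultimately show ?thesis using s t by (simp add: \<phi>_def)
  next
    case False
    then have "h y = \<infinity>" using nMI[of y] by (auto simp: D_def)
    then show ?thesis using \<open>\<gamma> > 0\<close> by simp
  qed
  have "is_arg_min (\<lambda>x. ereal \<gamma> * h x + ereal (1/2 * (norm (x - w))\<^sup>2)) (\<lambda>_. True)
          (prox (\<lambda>y. ereal \<gamma> * h y) w)"
    unfolding prox_def arg_min_def
    by (rule someI[of _ l]) (use min_l in \<open>auto simp: is_arg_min_def not_less\<close>)
  then show ?thesis by (simp add: is_arg_min_def not_less)
qed

text \<open>Fermat's rule: \<open>(w - a) / \<gamma>\<close> is a subgradient of \<open>h\<close> at the proximal point \<open>a\<close> of \<open>w\<close>.
  Comparing \<open>a\<close> with the point at fraction \<open>\<theta>\<close> of the segment towards \<open>y\<close>, convexity bounds the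
  change of \<open>h\<close> linearly in \<open>\<theta>\<close>, and the quadratic error disappears after division by \<open>\<theta> \<rightarrow> 0\<close>.\<close>

lemma prox_subgradient:
  fixes h :: "'a::euclidean_space \<Rightarrow> ereal"
  assumes closed: "closed_fun h" and proper: "proper_fun h" and convex: "convex_fun h"
    and "\<gamma> > 0" and minorant: "\<And>y. ereal (\<nu> \<bullet> y - c) \<le> h y"
  obtains t where "h (prox (\<lambda>y. ereal \<gamma> * h y) w) = ereal t"
    "\<And>y s. h y = ereal s \<Longrightarrow>
       t + (w - prox (\<lambda>y. ereal \<gamma> * h y) w) \<bullet> (y - prox (\<lambda>y. ereal \<gamma> * h y) w) / \<gamma> \<le> s"
proof -
  define a where "a = prox (\<lambda>y. ereal \<gamma> * h y) w"
  have min: "ereal \<gamma> * h a + ereal (1/2 * (norm (a - w))\<^sup>2)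
               \<le> ereal \<gamma> * h y + ereal (1/2 * (norm (y - w))\<^sup>2)" for y
    unfolding a_def by (rule prox_attained[OF closed proper \<open>\<gamma> > 0\<close> minorant])
  have nMI: "h y \<noteq> -\<infinity>" for y using minorant[of y] by auto
  obtain x0 where "\<bar>h x0\<bar> \<noteq> \<infinity>" using proper unfolding proper_fun_def by metis
  then have "h a \<noteq> \<infinity>" using min[of x0] \<open>\<gamma> > 0\<close> by auto
  then obtain t where t: "h a = ereal t" using nMI[of a] by (cases "h a") auto
  have sub: "t + (w - a) \<bullet> (y - a) / \<gamma> \<le> s" if s: "h y = ereal s" for y s
  proof -
    have step: "(w - a) \<bullet> (y - a) - 1/2 * (norm (y - a))\<^sup>2 * \<theta> \<le> \<gamma> * (s - t)"
      if \<theta>: "0 < \<theta>" "\<theta> \<le> 1" for \<theta>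
    proof -
      define p where "p = (1 - \<theta>) *\<^sub>R a + \<theta> *\<^sub>R y"
      have "h p \<le> ereal (1 - \<theta>) * h a + ereal \<theta> * h y"
        using convex \<theta> unfolding convex_fun_def p_def by auto
      then have hp: "h p \<le> ereal ((1 - \<theta>) * t + \<theta> * s)" using s t by simp
      obtain q where q: "h p = ereal q" using hp nMI[of p] by (cases "h p") auto
      have q_le: "\<gamma> * q \<le> \<gamma> * ((1 - \<theta>) * t + \<theta> * s)" using hp q \<open>\<gamma> > 0\<close> by simp
      have diff: "p - w = (a - w) + \<theta> *\<^sub>R (y - a)" unfolding p_def by (simp add: algebra_simps)
      have "(norm (p - w))\<^sup>2
          = (norm (a - w))\<^sup>2 - 2 * \<theta> * ((w - a) \<bullet> (y - a)) + \<theta>\<^sup>2 * (norm (y - a))\<^sup>2"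
        unfolding diff power2_norm_eq_inner
        by (simp add: inner_simps inner_commute algebra_simps power2_eq_square)
      then have "0 \<le> \<theta> * (\<gamma> * (s - t) - (w - a) \<bullet> (y - a) + 1/2 * (norm (y - a))\<^sup>2 * \<theta>)"
        using min[of p] t q q_le by (simp add: algebra_simps power2_eq_square)
      then show ?thesis using \<theta>(1) by (simp add: zero_le_mult_iff)
    qed
    have "((\<lambda>\<theta>. (w - a) \<bullet> (y - a) - 1/2 * (norm (y - a))\<^sup>2 * \<theta>)
            \<longlongrightarrow> (w - a) \<bullet> (y - a) - 1/2 * (norm (y - a))\<^sup>2 * 0) (at_right 0)"
      by (intro tendsto_intros)
    moreover have "\<forall>\<^sub>F \<theta> in at_right 0. (w - a) \<bullet> (y - a) - 1/2 * (norm (y - a))\<^sup>2 * \<theta> \<le> \<gamma> * (s - t)"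
      unfolding eventually_at_right_field using step by (intro exI[of _ 1]) auto
    ultimately have "(w - a) \<bullet> (y - a) \<le> \<gamma> * (s - t)"
      by (auto dest: tendsto_upperbound)
    then show ?thesis using \<open>\<gamma> > 0\<close> by (simp add: field_simps)
  qed
  show ?thesis using that[of t] t sub unfolding a_def by blast
qed

section \<open>Analysis of the iteration\<close>

text \<open>The two subgradient inequalities are all that the convergence argument uses of the
  proximal steps, and \<open>near_primal\<close>, \<open>near_dual\<close> are all that it uses of strong duality: nearly optimal
  points of both problems with values close to \<open>P\<close>. A dual point appears as a pair of affine
  minorants of slopes \<open>\<nu>\<close> and \<open>- \<nu>\<close>, with \<open>c\<close> and \<open>e\<close> in the role of the conjugate values.\<close>

locale douglas_rachford_run =
  fixes f g :: "'a::real_inner \<Rightarrow> ereal" and \<gamma> P :: real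
    and a b z :: "nat \<Rightarrow> 'a" and p q :: "nat \<Rightarrow> real"
  assumes gamma: "\<gamma> > 0"
    and f_a: "\<And>k. f (a k) = ereal (p k)"
    and g_b: "\<And>k. g (b k) = ereal (q k)"
    and f_subgradient: "\<And>k y s. f y = ereal s \<Longrightarrow> p k + (z k - a k) \<bullet> (y - a k) / \<gamma> \<le> s"
    and g_subgradient: "\<And>k y s. g y = ereal s \<Longrightarrow>
          q k + (2 *\<^sub>R a k - z k - b k) \<bullet> (y - b k) / \<gamma> \<le> s"
    and z_Suc: "\<And>k. z (Suc k) = z k + b k - a k"
    and near_primal: "\<And>\<epsilon>. \<epsilon> > 0 \<Longrightarrow>
          \<exists>x r s. f x = ereal r \<and> g x = ereal s \<and> r + s < P + \<epsilon>"
    and near_dual: "\<And>\<epsilon>. \<epsilon> > 0 \<Longrightarrow>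
          \<exists>\<nu> c e. (\<forall>y. ereal (\<nu> \<bullet> y - c) \<le> f y) \<and> (\<forall>y. ereal (- \<nu> \<bullet> y - e) \<le> g y)
                  \<and> P - \<epsilon> < - c - e"
begin

text \<open>The subgradients \<open>(z\<^sub>k - a\<^sub>k) / \<gamma>\<close> and \<open>(2 a\<^sub>k - z\<^sub>k - b\<^sub>k) / \<gamma>\<close> add up to \<open>- d\<^sub>k / \<gamma>\<close>, so the sum
  of the two inequalities is an inner product \<open>(z\<^sub>k\<^sub>+\<^sub>1 - z\<^sub>k) \<bullet> (x - z\<^sub>k\<^sub>+\<^sub>1) / \<gamma>\<close>, which polarises into
  a telescoping difference of squares.\<close>

lemma step_upper_bound:
  assumes "f x = ereal r" "g x = ereal s"
  shows "2 * \<gamma> * (p k + q k - (r + s))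
           \<le> (norm (x - z k))\<^sup>2 - (norm (x - z (Suc k)))\<^sup>2 - (norm (b k - a k))\<^sup>2"
proof -
  have 1: "\<gamma> * p k + (z k - a k) \<bullet> (x - a k) \<le> \<gamma> * r"
    using f_subgradient[OF assms(1), of k] gamma by (simp add: field_simps)
  have 2: "\<gamma> * q k + (2 *\<^sub>R a k - z k - b k) \<bullet> (x - b k) \<le> \<gamma> * s"
    using g_subgradient[OF assms(2), of k] gamma by (simp add: field_simps)
  have "(norm (x - z k))\<^sup>2 - (norm (x - z (Suc k)))\<^sup>2 - (norm (b k - a k))\<^sup>2
      = - 2 * ((z k - a k) \<bullet> (x - a k)) - 2 * ((2 *\<^sub>R a k - z k - b k) \<bullet> (x - b k))"
    unfolding power2_norm_eq_inner z_Suc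
    by (simp add: inner_simps inner_commute algebra_simps)
  then show ?thesis using 1 2 by (simp add: algebra_simps)
qed

lemma step_lower_bound:
  assumes "\<forall>y. ereal (\<nu> \<bullet> y - c) \<le> f y" "\<forall>y. ereal (- \<nu> \<bullet> y - e) \<le> g y"
  shows "- c - e - \<nu> \<bullet> (b k - a k) \<le> p k + q k"
proof -
  have "\<nu> \<bullet> a k - c \<le> p k" "- \<nu> \<bullet> b k - e \<le> q k"
    using assms f_a[of k] g_b[of k] by (metis ereal_less_eq(3))+
  then show ?thesis by (simp add: inner_simps)
qed

text \<open>Monotonicity of the subdifferentials of \<open>f\<close> and \<open>g\<close> between two consecutive steps makes
  \<open>z\<^sub>k \<mapsto> z\<^sub>k\<^sub>+\<^sub>1\<close> nonexpansive along the run. In the proof, \<open>dz\<close> is at once the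
  step \<open>b\<^sub>k - a\<^sub>k\<close> and the increment of \<open>z\<close>.\<close>

lemma norm_step_antimono: "norm (b (Suc k) - a (Suc k)) \<le> norm (b k - a k)"
proof -
  define da db dz where "da = a (Suc k) - a k" and "db = b (Suc k) - b k" and "dz = b k - a k"
  have f_mono: "0 \<le> (dz - da) \<bullet> da"
    using f_subgradient[OF f_a, of k "Suc k"] f_subgradient[OF f_a, of "Suc k" k] gamma
    by (simp add: field_simps z_Suc da_def dz_def inner_simps inner_commute)
  have g_mono: "0 \<le> (2 *\<^sub>R da - dz - db) \<bullet> db"
    using g_subgradient[OF g_b, of k "Suc k"] g_subgradient[OF g_b, of "Suc k" k] gamma
    by (simp add: field_simps z_Suc da_def db_def dz_def inner_simps inner_commute)
  have step: "b (Suc k) - a (Suc k) = dz + (db - da)"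
    by (simp add: da_def db_def dz_def)
  have "(norm (b (Suc k) - a (Suc k)))\<^sup>2 + (norm (db - da))\<^sup>2
     = (norm dz)\<^sup>2 - 2 * ((dz - da) \<bullet> da) - 2 * ((2 *\<^sub>R da - dz - db) \<bullet> db)"
    unfolding step power2_norm_eq_inner by (simp add: inner_simps inner_commute algebra_simps)
  then have "(norm (b (Suc k) - a (Suc k)))\<^sup>2 \<le> (norm dz)\<^sup>2"
    using f_mono g_mono zero_le_power2[of "norm (db - da)"] by linarith
  then show ?thesis by (simp add: dz_def)
qed

lemma telescoped_upper_bound:
  assumes "f x = ereal r" "g x = ereal s"
  shows "2 * \<gamma> * ((\<Sum>k<K. p k + q k) - real K * (r + s)) + (\<Sum>k<K. (norm (b k - a k))\<^sup>2)
           + (norm (x - z K))\<^sup>2 \<le> (norm (x - z 0))\<^sup>2"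
proof (induction K)
  case (Suc K)
  then show ?case using step_upper_bound[OF assms, of K] by (simp add: algebra_simps)
qed simp

lemma telescoped_lower_bound:
  assumes "\<forall>y. ereal (\<nu> \<bullet> y - c) \<le> f y" "\<forall>y. ereal (- \<nu> \<bullet> y - e) \<le> g y"
  shows "real K * (- c - e) - \<nu> \<bullet> (z K - z 0) \<le> (\<Sum>k<K. p k + q k)"
proof (induction K)
  case (Suc K)
  then show ?case using step_lower_bound[OF assms, of K]
    by (simp add: z_Suc inner_simps algebra_simps)
qed simp

text \<open>The upper bound at a nearly optimal \<open>x\<close> minus the lower bound at a nearly optimal \<open>\<nu>\<close>. The
  lower bound leaves a term linear in \<open>x - z\<^sub>K\<close>, which half of the available \<open>\<parallel>x - z\<^sub>K\<parallel>\<^sup>2\<close> absorbs.\<close>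

lemma energy_bound:
  assumes "\<epsilon> > 0"
  shows "\<exists>x B. \<forall>K. (\<Sum>k<K. (norm (b k - a k))\<^sup>2) + 1/2 * (norm (x - z K))\<^sup>2 \<le> \<epsilon> * real K + B"
proof -
  \<comment> \<open>The gap between the two values is at most \<open>2 \<delta>\<close>, and it enters with the factor \<open>2 \<gamma>\<close>.\<close>
  define \<delta> where "\<delta> = \<epsilon> / (4 * \<gamma>)"
  have "\<delta> > 0" using assms gamma by (simp add: \<delta>_def)
  obtain x r s where x: "f x = ereal r" "g x = ereal s" "r + s < P + \<delta>"
    using near_primal[OF \<open>\<delta> > 0\<close>] by blast
  obtain \<nu> c e where d: "\<forall>y. ereal (\<nu> \<bullet> y - c) \<le> f y" "\<forall>y. ereal (- \<nu> \<bullet> y - e) \<le> g y"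
      "P - \<delta> < - c - e"
    using near_dual[OF \<open>\<delta> > 0\<close>] by blast
  define B where "B = (norm (x - z 0))\<^sup>2 + 2 * \<gamma> * (\<nu> \<bullet> (x - z 0)) + 2 * \<gamma>\<^sup>2 * (norm \<nu>)\<^sup>2"
  have "(\<Sum>k<K. (norm (b k - a k))\<^sup>2) + 1/2 * (norm (x - z K))\<^sup>2 \<le> \<epsilon> * real K + B" for K
  proof -
    define U L W where "U = real K * (r + s)" and "L = real K * (- c - e)" and "W = (\<Sum>k<K. p k + q k)"
    define \<beta>\<^sub>0 \<beta> where "\<beta>\<^sub>0 = \<nu> \<bullet> (x - z 0)" and "\<beta> = \<nu> \<bullet> (x - z K)"
    have upper: "2 * \<gamma> * (W - U) + (\<Sum>k<K. (norm (b k - a k))\<^sup>2) + (norm (x - z K))\<^sup>2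
        \<le> (norm (x - z 0))\<^sup>2"
      using telescoped_upper_bound[OF x(1,2), of K] by (simp add: U_def W_def)
    have "L - (\<beta>\<^sub>0 - \<beta>) \<le> W"
      using telescoped_lower_bound[OF d(1,2), of K]
      by (simp add: L_def W_def \<beta>\<^sub>0_def \<beta>_def inner_simps)
    then have lower: "2 * \<gamma> * (L - (\<beta>\<^sub>0 - \<beta>)) \<le> 2 * \<gamma> * W" using gamma by simp
    have "real K * ((r + s) - (- c - e)) \<le> real K * (2 * \<delta>)"
      using x(3) d(3) by (intro mult_left_mono) auto
    then have "U - L \<le> real K * (2 * \<delta>)"
      by (simp add: U_def L_def right_diff_distrib)
    then have "2 * \<gamma> * (U - L) \<le> 2 * \<gamma> * (real K * (2 * \<delta>))"
      by (rule mult_left_mono) (use gamma in simp)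
    also have "\<dots> = \<epsilon> * real K" using gamma by (simp add: \<delta>_def)
    finally have gap: "2 * \<gamma> * (U - L) \<le> \<epsilon> * real K" .
    have "0 \<le> 1/2 * (norm (2 *\<^sub>R (\<gamma> *\<^sub>R \<nu>) + (x - z K)))\<^sup>2" by simp
    also have "\<dots> = 2 * \<gamma>\<^sup>2 * (norm \<nu>)\<^sup>2 + 2 * \<gamma> * \<beta> + 1/2 * (norm (x - z K))\<^sup>2"
      unfolding power2_norm_eq_inner \<beta>_def
      by (simp add: inner_simps inner_commute algebra_simps power2_eq_square)
    finally show ?thesis using upper lower gap
      unfolding B_def \<beta>\<^sub>0_def[symmetric] by (simp add: algebra_simps)
  qed
  then show ?thesis by blast
qed

text \<open>A decreasing sequence is bounded by its averages, and those of \<open>\<parallel>d\<^sub>k\<parallel>\<^sup>2\<close> are eventually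
  below any \<open>\<epsilon>\<close> by the energy bound.\<close>

lemma step_tendsto_zero: "(\<lambda>k. b k - a k) \<longlonglongrightarrow> 0"
proof -
  have dec: "norm (b K - a K) \<le> norm (b k - a k)" if "k \<le> K" for k K
    using lift_Suc_antimono_le[of "\<lambda>k. norm (b k - a k)", OF norm_step_antimono that] .
  have sq: "(\<lambda>k. (norm (b k - a k))\<^sup>2) \<longlonglongrightarrow> 0"
  proof (rule LIMSEQ_I)
    fix \<epsilon> :: real assume "0 < \<epsilon>"
    obtain x B where B: "\<And>K. (\<Sum>k<K. (norm (b k - a k))\<^sup>2) + 1/2 * (norm (x - z K))\<^sup>2
        \<le> \<epsilon>/2 * real K + B"
      using energy_bound[of "\<epsilon>/2"] \<open>0 < \<epsilon>\<close> by auto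
    obtain N :: nat where N: "2 * \<bar>B\<bar> / \<epsilon> < real N" using reals_Archimedean2 by blast
    have "(norm (b K - a K))\<^sup>2 < \<epsilon>" if "K \<ge> N" for K
    proof -
      have "real (Suc K) * (norm (b K - a K))\<^sup>2 = (\<Sum>k<Suc K. (norm (b K - a K))\<^sup>2)" by simp
      also have "\<dots> \<le> (\<Sum>k<Suc K. (norm (b k - a k))\<^sup>2)"
        by (intro sum_mono power_mono dec) auto
      also have "\<dots> \<le> \<epsilon>/2 * real (Suc K) + B"
        using B[of "Suc K"] zero_le_power2[of "norm (x - z (Suc K))"] by linarith
      also have "B < \<epsilon>/2 * real (Suc K)"
      proof -
        have "2 * \<bar>B\<bar> / \<epsilon> < real (Suc K)" using N that by simp
        then show ?thesis using \<open>0 < \<epsilon>\<close> by (simp add: divide_less_eq mult.commute)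
      qed
      finally have "real (Suc K) * (norm (b K - a K))\<^sup>2 < real (Suc K) * \<epsilon>"
        by (simp add: algebra_simps)
      then show ?thesis by (simp add: mult_less_cancel_left)
    qed
    then show "\<exists>N. \<forall>n\<ge>N. norm ((norm (b n - a n))\<^sup>2 - 0) < \<epsilon>" by auto
  qed
  have "(\<lambda>k. norm (b k - a k)) \<longlonglongrightarrow> 0"
    using tendsto_real_sqrt[OF sq] by simp
  then show ?thesis by (rule tendsto_norm_zero_cancel)
qed

text \<open>Keeping the other term of the energy bound shows that \<open>\<parallel>x - z\<^sub>K\<parallel>\<close> grows at most like the
  square root of \<open>K\<close>.\<close>

lemma average_displacement_tendsto_zero: "(\<lambda>K. (z K - z 0) /\<^sub>R real K) \<longlonglongrightarrow> 0"
proof -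
  obtain x B where B: "\<And>K. (\<Sum>k<K. (norm (b k - a k))\<^sup>2) + 1/2 * (norm (x - z K))\<^sup>2
      \<le> 1 * real K + B"
    using energy_bound[of 1] by auto
  have r: "norm (x - z K) \<le> sqrt (2 * (real K + B))" for K
  proof (rule real_le_rsqrt)
    have "0 \<le> (\<Sum>k<K. (norm (b k - a k))\<^sup>2)" by (intro sum_nonneg) simp
    then show "(norm (x - z K))\<^sup>2 \<le> 2 * (real K + B)" using B[of K] by simp
  qed
  show ?thesis
  proof (rule Lim_null_comparison)
    show "\<forall>\<^sub>F K in sequentially. norm ((z K - z 0) /\<^sub>R real K)
            \<le> sqrt (2 * (1 / real K + B * (1 / real K)\<^sup>2)) + norm (x - z 0) * (1 / real K)"
    proof (rule eventually_mono[OF eventually_gt_at_top[of 0]])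
      fix K :: nat assume K: "0 < K"
      have "norm (z K - z 0) \<le> norm (x - z K) + norm (x - z 0)"
        using norm_triangle_ineq4[of "x - z 0" "x - z K"] by simp
      also have "\<dots> \<le> sqrt (2 * (real K + B)) + norm (x - z 0)" using r by simp
      finally have "norm (z K - z 0) / real K
          \<le> (sqrt (2 * (real K + B)) + norm (x - z 0)) / real K"
        by (rule divide_right_mono) simp
      also have "\<dots> = sqrt (2 * (real K + B)) / real K + norm (x - z 0) * (1 / real K)"
        by (simp add: add_divide_distrib)
      also have "sqrt (2 * (real K + B)) / real K = sqrt (2 * (real K + B) / (real K)\<^sup>2)"
        by (simp add: real_sqrt_divide)
      also have "2 * (real K + B) / (real K)\<^sup>2 = 2 * (1 / real K + B * (1 / real K)\<^sup>2)"
        using K by (simp add: field_simps power2_eq_square)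
      finally show "norm ((z K - z 0) /\<^sub>R real K)
          \<le> sqrt (2 * (1 / real K + B * (1 / real K)\<^sup>2)) + norm (x - z 0) * (1 / real K)"
        by (simp add: divide_inverse mult.commute)
    qed
    have "(\<lambda>K. sqrt (2 * (1 / real K + B * (1 / real K)\<^sup>2)) + norm (x - z 0) * (1 / real K))
        \<longlonglongrightarrow> sqrt (2 * (0 + B * 0\<^sup>2)) + norm (x - z 0) * 0"
      by (intro tendsto_intros lim_1_over_n)
    then show "(\<lambda>K. sqrt (2 * (1 / real K + B * (1 / real K)\<^sup>2)) + norm (x - z 0) * (1 / real K))
        \<longlonglongrightarrow> 0" by simp
  qed
qed

lemma average_tendsto: "(\<lambda>K. (\<Sum>k<K. p k + q k) / real K) \<longlonglongrightarrow> P"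
proof (rule order_tendstoI)
  fix y assume "y < P"
  then obtain \<nu> c e where d: "\<forall>y. ereal (\<nu> \<bullet> y - c) \<le> f y" "\<forall>y. ereal (- \<nu> \<bullet> y - e) \<le> g y"
      "y < - c - e"
    using near_dual[of "P - y"] by auto
  have "(\<lambda>K. - c - e - \<nu> \<bullet> ((z K - z 0) /\<^sub>R real K)) \<longlonglongrightarrow> - c - e - \<nu> \<bullet> 0"
    by (intro tendsto_intros average_displacement_tendsto_zero)
  then have "\<forall>\<^sub>F K in sequentially. y < - c - e - \<nu> \<bullet> ((z K - z 0) /\<^sub>R real K)"
    using d(3) by (intro order_tendstoD) auto
  then show "\<forall>\<^sub>F K in sequentially. y < (\<Sum>k<K. p k + q k) / real K"
    using eventually_gt_at_top[of 0]
  proof eventually_elim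
    case (elim K)
    have "(real K * (- c - e) - \<nu> \<bullet> (z K - z 0)) / real K \<le> (\<Sum>k<K. p k + q k) / real K"
      by (rule divide_right_mono[OF telescoped_lower_bound[OF d(1,2)]]) simp
    moreover have "(real K * (- c - e) - \<nu> \<bullet> (z K - z 0)) / real K
        = - c - e - \<nu> \<bullet> ((z K - z 0) /\<^sub>R real K)"
      using elim(2) by (simp add: diff_divide_distrib inverse_eq_divide)
    ultimately show ?case using elim(1) by linarith
  qed
next
  fix y assume "P < y"
  then obtain x r s where x: "f x = ereal r" "g x = ereal s" "r + s < y"
    using near_primal[of "y - P"] by auto
  define C where "C = (norm (x - z 0))\<^sup>2 / (2 * \<gamma>)"
  have "(\<lambda>K. r + s + C * (1 / real K)) \<longlonglongrightarrow> r + s + C * 0"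
    by (intro tendsto_intros lim_1_over_n)
  then have "\<forall>\<^sub>F K in sequentially. r + s + C * (1 / real K) < y"
    using x(3) by (intro order_tendstoD) auto
  then show "\<forall>\<^sub>F K in sequentially. (\<Sum>k<K. p k + q k) / real K < y"
    using eventually_gt_at_top[of 0]
  proof eventually_elim
    case (elim K)
    have "0 \<le> (\<Sum>k<K. (norm (b k - a k))\<^sup>2)" by (intro sum_nonneg) simp
    then have "2 * \<gamma> * ((\<Sum>k<K. p k + q k) - real K * (r + s)) \<le> (norm (x - z 0))\<^sup>2"
      using telescoped_upper_bound[OF x(1,2), of K] zero_le_power2[of "norm (x - z K)"] by linarith
    then have "(\<Sum>k<K. p k + q k) - real K * (r + s) \<le> C"
      unfolding C_def using gamma by (simp add: pos_le_divide_eq mult.commute)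
    then have "(\<Sum>k<K. p k + q k) / real K \<le> r + s + C * (1 / real K)"
      using elim(2) by (simp add: field_simps)
    then show ?case using elim(1) by linarith
  qed
qed

lemma eventually_value_greater:
  assumes "y < P"
  shows "\<forall>\<^sub>F k in sequentially. y < p k + q k"
proof -
  obtain \<nu> c e where d: "\<forall>y. ereal (\<nu> \<bullet> y - c) \<le> f y" "\<forall>y. ereal (- \<nu> \<bullet> y - e) \<le> g y"
      "y < - c - e"
    using near_dual[of "P - y"] assms by auto
  have "(\<lambda>k. - c - e - \<nu> \<bullet> (b k - a k)) \<longlonglongrightarrow> - c - e - \<nu> \<bullet> 0"
    by (intro tendsto_intros step_tendsto_zero)
  then have "\<forall>\<^sub>F k in sequentially. y < - c - e - \<nu> \<bullet> (b k - a k)"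
    using d(3) by (intro order_tendstoD) auto
  then show ?thesis
    by (rule eventually_mono) (use step_lower_bound[OF d(1,2)] in \<open>blast intro: less_le_trans\<close>)
qed

text \<open>If the values stayed above \<open>y > P\<close>, then, for \<open>x\<close> with \<open>f x + g x < y\<close>, every step would
  decrease \<open>\<parallel>x - z\<^sub>k\<parallel>\<^sup>2\<close> by at least a fixed amount.\<close>

lemma not_eventually_value_greater:
  assumes "P < y"
  shows "\<not> (\<forall>\<^sub>F k in sequentially. y < p k + q k)"
proof
  assume "\<forall>\<^sub>F k in sequentially. y < p k + q k"
  then obtain N where N: "\<And>k. k \<ge> N \<Longrightarrow> y < p k + q k"
    unfolding eventually_sequentially by blast
  obtain x r s where x: "f x = ereal r" "g x = ereal s" "r + s < y"
    using near_primal[of "y - P"] assms by auto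
  define \<delta> where "\<delta> = 2 * \<gamma> * (y - (r + s))"
  have "\<delta> > 0" using x(3) gamma by (simp add: \<delta>_def)
  have desc: "(norm (x - z (N + m)))\<^sup>2 \<le> (norm (x - z N))\<^sup>2 - real m * \<delta>" for m
  proof (induction m)
    case (Suc m)
    have "\<delta> \<le> 2 * \<gamma> * (p (N + m) + q (N + m) - (r + s))"
      unfolding \<delta>_def using N[of "N + m"] gamma by simp
    then show ?case
      using Suc step_upper_bound[OF x(1,2), of "N + m"] zero_le_power2[of "norm (b (N + m) - a (N + m))"]
      unfolding add_Suc_right of_nat_Suc distrib_right mult_1 by linarith
  qed simp
  obtain m :: nat where m: "(norm (x - z N))\<^sup>2 / \<delta> < real m" using reals_Archimedean2 by blast
  then have "(norm (x - z N))\<^sup>2 < real m * \<delta>" using \<open>\<delta> > 0\<close> by (simp add: pos_divide_less_eq)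
  then show False using desc[of m] zero_le_power2[of "norm (x - z (N + m))"] by linarith
qed

lemma liminf_value: "liminf (\<lambda>k. f (a k) + g (b k)) = ereal P"
proof (rule antisym)
  show "ereal P \<le> liminf (\<lambda>k. f (a k) + g (b k))"
    unfolding le_Liminf_iff
  proof (intro allI impI)
    fix y assume "y < ereal P"
    then obtain t where t: "y < ereal t" "t < P"
      using ereal_dense2[of y "ereal P"] by auto
    show "\<forall>\<^sub>F k in sequentially. y < f (a k) + g (b k)"
      by (rule eventually_mono[OF eventually_value_greater[OF t(2)]])
         (use t(1) in \<open>auto simp: f_a g_b intro: less_trans\<close>)
  qed
  show "liminf (\<lambda>k. f (a k) + g (b k)) \<le> ereal P"
  proof (rule ccontr)
    assume "\<not> ?thesis"
    then obtain t where t: "P < t" "ereal t < liminf (\<lambda>k. f (a k) + g (b k))"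
      using ereal_dense2[of "ereal P" "liminf (\<lambda>k. f (a k) + g (b k))"] by (auto simp: not_le)
    have "\<forall>\<^sub>F k in sequentially. ereal t < f (a k) + g (b k)"
      using t(2) by (rule less_LiminfD)
    then show False using not_eventually_value_greater[OF t(1)] by (simp add: f_a g_b)
  qed
qed

end

section \<open>Convergence when the primal optimum is not attained\<close>

theorem theorem7:
  fixes f g :: "real ^ 'n \<Rightarrow> ereal"
    and \<gamma> :: real
    and z0 :: "real ^ 'n"
    and xh x z :: "nat \<Rightarrow> real ^ 'n"
  assumes f_range: "\<And>y. f y \<noteq> -\<infinity>"
    and g_range: "\<And>y. g y \<noteq> -\<infinity>"
    and f: "closed_fun f" "proper_fun f" "convex_fun f"
    and g: "closed_fun g" "proper_fun g" "convex_fun g"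
    and gamma: "\<gamma> > 0"
    and iterates: "drs_iterates f g \<gamma> z0 xh x z"
    and strong_duality: "dual_value f g = primal_value f g"
    and finite_value: "\<bar>primal_value f g\<bar> \<noteq> \<infinity>"
    and feasible: "primal_feasible f g"
    and no_solution: "\<not> (\<exists>y. primal_solution f g y)"
  shows "(\<lambda>k. x (Suc k) - xh k) \<longlonglongrightarrow> 0 \<and>
    (\<lambda>k. (\<Sum>i=0..k. f (xh i) + g (x (Suc i))) / ereal (real (k + 1)))
      \<longlonglongrightarrow> primal_value f g \<and>
    liminf (\<lambda>k. f (xh k) + g (x (Suc k))) = primal_value f g \<and>
    \<not> convergent (\<lambda>k. (xh k, x (Suc k)))"
proof -
  obtain P where P: "primal_value f g = ereal P" using finite_value by auto
  have near_primal: "\<exists>x r s. f x = ereal r \<and> g x = ereal s \<and> r + s < P + \<epsilon>" if "\<epsilon> > 0" for \<epsilon>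
  proof -
    have "(INF x. f x + g x) < ereal (P + \<epsilon>)" using P that by (simp add: primal_value_def)
    then obtain y where y: "f y + g y < ereal (P + \<epsilon>)" by (auto simp: INF_less_iff)
    then obtain r s where "f y = ereal r" "g y = ereal s"
      using f_range[of y] g_range[of y] by (cases "f y"; cases "g y") auto
    then show ?thesis using y by auto
  qed
  have near_dual: "\<exists>\<nu> c e. (\<forall>y. ereal (\<nu> \<bullet> y - c) \<le> f y) \<and> (\<forall>y. ereal (- \<nu> \<bullet> y - e) \<le> g y)
      \<and> P - \<epsilon> < - c - e" if "\<epsilon> > 0" for \<epsilon>
  proof -
    have "ereal (P - \<epsilon>) < (SUP \<nu>. - conjugate f \<nu> - conjugate g (- \<nu>))"
      using P that strong_duality by (simp add: dual_value_def)
    then obtain \<nu> where \<nu>: "ereal (P - \<epsilon>) < - conjugate f \<nu> - conjugate g (- \<nu>)"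
      by (auto simp: less_SUP_iff)
    then obtain c e where ce: "conjugate f \<nu> = ereal c" "conjugate g (- \<nu>) = ereal e"
      using conjugate_not_MInfty[OF f(2), of \<nu>] conjugate_not_MInfty[OF g(2), of "- \<nu>"]
      by (cases "conjugate f \<nu>"; cases "conjugate g (- \<nu>)") auto
    then show ?thesis
      using \<nu> conjugate_affine_minorant[OF ce(1) f_range] conjugate_affine_minorant[OF ce(2) g_range]
      by (intro exI[of _ \<nu>] exI[of _ c] exI[of _ e]) auto
  qed
  \<comment> \<open>Any dual feasible point will do here: its minorants make the proximal points exist.\<close>
  obtain \<nu> c e where min: "\<And>y. ereal (\<nu> \<bullet> y - c) \<le> f y" "\<And>y. ereal (- \<nu> \<bullet> y - e) \<le> g y"
    using near_dual[of 1] by auto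
  have xh: "xh k = prox (\<lambda>y. ereal \<gamma> * f y) (z k)"
    and x: "x (Suc k) = prox (\<lambda>y. ereal \<gamma> * g y) (2 *\<^sub>R xh k - z k)"
    and z: "z (Suc k) = z k + x (Suc k) - xh k" for k
    using iterates by (auto simp: drs_iterates_def)
  have "\<exists>t. f (xh k) = ereal t \<and>
      (\<forall>y s. f y = ereal s \<longrightarrow> t + (z k - xh k) \<bullet> (y - xh k) / \<gamma> \<le> s)" for k
    unfolding xh by (rule prox_subgradient[OF f gamma min(1), of "z k"]) blast
  then obtain p where p: "\<And>k. f (xh k) = ereal (p k)"
      "\<And>k y s. f y = ereal s \<Longrightarrow> p k + (z k - xh k) \<bullet> (y - xh k) / \<gamma> \<le> s"
    by metis
  have "\<exists>t. g (x (Suc k)) = ereal t \<and>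
      (\<forall>y s. g y = ereal s \<longrightarrow>
        t + (2 *\<^sub>R xh k - z k - x (Suc k)) \<bullet> (y - x (Suc k)) / \<gamma> \<le> s)" for k
    unfolding x by (rule prox_subgradient[OF g gamma min(2), of "2 *\<^sub>R xh k - z k"]) blast
  then obtain q where q: "\<And>k. g (x (Suc k)) = ereal (q k)"
      "\<And>k y s. g y = ereal s \<Longrightarrow>
        q k + (2 *\<^sub>R xh k - z k - x (Suc k)) \<bullet> (y - x (Suc k)) / \<gamma> \<le> s"
    by metis
  interpret run: douglas_rachford_run f g \<gamma> P xh "\<lambda>k. x (Suc k)" z p q
    by unfold_locales (fact gamma p q z near_primal near_dual)+
  have average: "(\<lambda>k. (\<Sum>i=0..k. f (xh i) + g (x (Suc i))) / ereal (real (k + 1)))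
      \<longlonglongrightarrow> primal_value f g"
  proof -
    have "(\<lambda>k. ereal ((\<Sum>i<Suc k. p i + q i) / real (Suc k))) \<longlonglongrightarrow> ereal P"
      using LIMSEQ_Suc[OF run.average_tendsto] by simp
    moreover have "{0..k} = {..<Suc k}" for k by auto
    ultimately show ?thesis by (simp add: P p(1) q(1))
  qed
  have "\<not> convergent (\<lambda>k. (xh k, x (Suc k)))"
  proof
    assume "convergent (\<lambda>k. (xh k, x (Suc k)))"
    then obtain l l' where "(\<lambda>k. (xh k, x (Suc k))) \<longlonglongrightarrow> (l, l')"
      unfolding convergent_def by auto
    then have l: "xh \<longlonglongrightarrow> l" "(\<lambda>k. x (Suc k)) \<longlonglongrightarrow> l'"
      using tendsto_fst tendsto_snd by fastforce+
    have "l' - l = 0"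
      using LIMSEQ_unique[OF tendsto_diff[OF l(2,1)] run.step_tendsto_zero] .
    then have l': "(\<lambda>k. x (Suc k)) \<longlonglongrightarrow> l" using l(2) by simp
    let ?F = "liminf (\<lambda>k. f (xh k))" and ?G = "liminf (\<lambda>k. g (x (Suc k)))"
    have F: "f l \<le> ?F" and G: "g l \<le> ?G"
      using closed_fun_le_liminf f(1) g(1) l(1) l' by blast+
    then have "?F \<noteq> -\<infinity>" "?G \<noteq> -\<infinity>" using f_range[of l] g_range[of l] by auto
    then have "?F + ?G \<le> liminf (\<lambda>k. f (xh k) + g (x (Suc k)))"
      by (intro ereal_liminf_add_mono) auto
    then have "f l + g l \<le> primal_value f g"
      using add_mono[OF F G] run.liminf_value P by simp
    moreover have "primal_value f g \<le> f l + g l"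
      unfolding primal_value_def by (rule INF_lower) simp
    ultimately show False using no_solution unfolding primal_solution_def by force
  qed
  then show ?thesis
    using run.step_tendsto_zero average run.liminf_value P by simp
qed

end
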